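(* Let $E \subseteq \mathbb{N}$. Then the equality $\overline{p}(\mu(E)) = \overline{p}_{\mu}(E)$ holds for every scaling function $\mu :\mathbb{N} \to \mathbb{R}^+$.
   Context: $\mathbb{R}^+=[0,\infty)$. For $X\subseteq\mathbb{R}^+$ and $h>0$, $\lambda(X,h)$ is the length of the largest open subinterval of $(0,h)$ that contains no point of $X$ (it is $0$ if there is no such nonempty interval), and the right upper porosity of $X$ at $0$ is $\overline{p}(X)=\limsup_{h\to0^+}\lambda(X,h)/h$. A scaling function is a strictly decreasing function $\mu:\mathbb{N}\to\mathbb{R}^+$ with $\lim_{n\to\infty}\mu(n)=0$. For $E\subseteq\mathbb{N}$ and $n\in\mathbb{N}$, $$\lambda_\mu(E,n)=\sup\{|\mu(n^{(1)})-\mu(n^{(2)})| : n\le n^{(1)}<n^{(2)},\ n^{(1)},n^{(2)}\in\mathbb{N},\ (n^{(1)},n^{(2)})\cap E=\emptyset\},$$ and the upper porosity of $E$ at infinity is $\overline{p}_\mu(E)=\limsup_{n\to\infty}\lambda_\mu(E,n)/\mu(n)$. *)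

theory Defs
  imports "HOL-Analysis.Analysis"
begin

(* The degenerate interval a = b gives length 0, so the supremum is 0 when no nonempty
   open subinterval of (0,h) misses X.  For h > 0 the set of lengths is nonempty and
   bounded above by h, and the supremum is attained: it is the length of a largest gap. *)
definition gap_length :: "real set \<Rightarrow> real \<Rightarrow> real" where
  "gap_length X h =
     Sup {b - a | a b. a \<le> b \<and> {a<..<b} \<subseteq> {0<..<h} \<and> {a<..<b} \<inter> X = {}}"

definition right_upper_porosity :: "real set \<Rightarrow> ereal" where
  "right_upper_porosity X = Limsup (at_right 0) (\<lambda>h. ereal (gap_length X h / h))"

definition scaling_function :: "(nat \<Rightarrow> real) \<Rightarrow> bool" where
  "scaling_function \<mu> \<longleftrightarrow>
     range \<mu> \<subseteq> {0..} \<and> strict_antimono_on UNIV \<mu> \<and> \<mu> \<longlonglongrightarrow> 0"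

(* For a scaling function the set below is nonempty (take n2 = n1 + 1) and bounded above
   by \<mu> n, so the real supremum is the genuine one. *)
definition scaled_gap :: "(nat \<Rightarrow> real) \<Rightarrow> nat set \<Rightarrow> nat \<Rightarrow> real" where
  "scaled_gap \<mu> E n =
     Sup {\<bar>\<mu> n1 - \<mu> n2\<bar> | n1 n2. n \<le> n1 \<and> n1 < n2 \<and> {n1<..<n2} \<inter> E = {}}"

definition upper_porosity_at_infinity :: "(nat \<Rightarrow> real) \<Rightarrow> nat set \<Rightarrow> ereal" where
  "upper_porosity_at_infinity \<mu> E = limsup (\<lambda>n. ereal (scaled_gap \<mu> E n / \<mu> n))"

end

theory Submission
  imports Defs
begin

text \<open>
  The estimate \<open>scaled_gap \<mu> E n \<le> gap_length (\<mu> ` E) (\<mu> n)\<close> gives one inequality. For the other, let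
  \<open>\<mu> (n + 1) < h \<le> \<mu> n\<close> and consider a gap \<open>(a, b)\<close> of \<open>\<mu> ` E\<close> in \<open>(0, h)\<close>. If \<open>b \<le> \<mu> (n + 1)\<close>,
  the gap extends upwards to one ending at some \<open>\<mu> k\<close> with \<open>k \<ge> n + 1\<close>, so its relative length is at
  most the porosity quotient at \<open>n + 1\<close>. If \<open>b > \<mu> (n + 1)\<close>, it extends to \<open>(a, \<mu> n)\<close>, and
  \<open>(b - a) / h \<le> 1 - a / h \<le> 1 - a / \<mu> n\<close> is at most the quotient at \<open>n\<close>.
\<close>

section \<open>Order and bracketing for scaling functions\<close>

lemma scaling_function_less_iff:
  assumes "scaling_function \<mu>"
  shows "\<mu> m < \<mu> n \<longleftrightarrow> n < m"
proof -
  have "\<mu> j < \<mu> i" if "i < j" for i j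
    using assms that by (auto simp: scaling_function_def monotone_on_def)
  then show ?thesis
    by (metis less_asym linorder_neqE_nat less_irrefl)
qed

lemma scaling_function_le_iff:
  assumes "scaling_function \<mu>"
  shows "\<mu> m \<le> \<mu> n \<longleftrightarrow> n \<le> m"
  using scaling_function_less_iff[OF assms] by (metis not_less)

lemma scaling_function_pos:
  assumes "scaling_function \<mu>"
  shows "0 < \<mu> n"
proof -
  have "0 \<le> \<mu> (Suc n)"
    using assms by (auto simp: scaling_function_def)
  also have "\<dots> < \<mu> n"
    by (simp add: scaling_function_less_iff[OF assms])
  finally show ?thesis .
qed

lemma scaling_function_tendsto: "scaling_function \<mu> \<Longrightarrow> \<mu> \<longlonglongrightarrow> 0"
  by (simp add: scaling_function_def)

text \<open>Here \<open>Suc n\<close> is the first index whose value drops below \<open>h\<close>,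
  and \<open>h \<le> \<mu> m\<close> puts it beyond \<open>m\<close>. Used to locate both scales
  \<open>h\<close> and right ends of gaps.\<close>

lemma scaling_function_bracket:
  assumes "scaling_function \<mu>" "0 < h" "h \<le> \<mu> m"
  obtains n where "m \<le> n" "\<mu> (Suc n) < h" "h \<le> \<mu> n"
proof -
  have "\<forall>\<^sub>F n in sequentially. \<mu> n < h"
    using order_tendstoD(2)[OF scaling_function_tendsto] assms by blast
  then have ex: "\<exists>n. \<mu> n < h"
    by (auto simp: eventually_sequentially)
  define k where "k = (LEAST n. \<mu> n < h)"
  have k: "\<mu> k < h"
    unfolding k_def using ex by (rule LeastI_ex)
  then have mk: "m < k"
    using assms scaling_function_less_iff[OF assms(1)] by (meson less_le_trans)
  then obtain n where n: "k = Suc n"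
    by (cases k) auto
  have "\<not> \<mu> n < h"
    using not_less_Least[of n "\<lambda>n. \<mu> n < h"] n by (simp add: k_def)
  then show ?thesis
    using that[of n] k mk n by simp
qed

section \<open>Elementary bounds for the two suprema\<close>

lemma gap_length_ge:
  assumes "a \<le> b" "{a<..<b} \<subseteq> {0<..<h}" "{a<..<b} \<inter> X = {}" "0 < h"
  shows "b - a \<le> gap_length X h"
  unfolding gap_length_def
proof (rule cSup_upper)
  \<comment> \<open>For \<open>a = b\<close> the inclusion says nothing about the endpoints, but the
    length is then 0.\<close>
  have "b - a \<le> h" if "a \<le> b" "{a<..<b} \<subseteq> {0<..<h}" for a b :: real
    using that \<open>0 < h\<close> by (cases "a = b") (auto simp: greaterThanLessThan_subseteq_greaterThanLessThan)
  then show "bdd_above {b - a | a b. a \<le> b \<and> {a<..<b} \<subseteq> {0<..<h} \<and> {a<..<b} \<inter> X = {}}"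
    by (intro bdd_aboveI[of _ h]) blast
qed (use assms in blast)

text \<open>The premise \<open>0 \<le> C\<close> absorbs the degenerate intervals; for proper ones
  the inclusion becomes inequalities between endpoints.\<close>

lemma gap_length_le:
  assumes "0 \<le> C"
    and "\<And>a b. \<lbrakk>0 \<le> a; a < b; b \<le> h; {a<..<b} \<inter> X = {}\<rbrakk> \<Longrightarrow> b - a \<le> C"
  shows "gap_length X h \<le> C"
  unfolding gap_length_def
proof (rule cSup_least)
  show "{b - a | a b. a \<le> b \<and> {a<..<b} \<subseteq> {0<..<h} \<and> {a<..<b} \<inter> X = {}} \<noteq> {}"
    by (auto intro!: exI[of _ 0])
next
  fix x assume "x \<in> {b - a | a b. a \<le> b \<and> {a<..<b} \<subseteq> {0<..<h} \<and> {a<..<b} \<inter> X = {}}"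
  then obtain a b where ab: "x = b - a" "a \<le> b" "{a<..<b} \<subseteq> {0<..<h}" "{a<..<b} \<inter> X = {}"
    by blast
  show "x \<le> C"
  proof (cases "a = b")
    case True
    then show ?thesis using ab assms(1) by simp
  next
    case False
    then show ?thesis
      using ab assms(2)[of a b] by (simp add: greaterThanLessThan_subseteq_greaterThanLessThan)
  qed
qed

lemma scaled_gap_ge:
  assumes "scaling_function \<mu>" "n \<le> n1" "n1 < n2" "{n1<..<n2} \<inter> E = {}"
  shows "\<mu> n1 - \<mu> n2 \<le> scaled_gap \<mu> E n"
proof -
  have "\<bar>\<mu> n1 - \<mu> n2\<bar> \<le> scaled_gap \<mu> E n"
    unfolding scaled_gap_def
  proof (rule cSup_upper)
    have "\<bar>\<mu> n1 - \<mu> n2\<bar> \<le> \<mu> n" if "n \<le> n1" "n1 < n2" for n1 n2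
      using that scaling_function_pos[OF assms(1), of n2] scaling_function_less_iff[OF assms(1), of n2 n1]
        scaling_function_le_iff[OF assms(1), of n1 n] by simp
    then show "bdd_above {\<bar>\<mu> n1 - \<mu> n2\<bar> | n1 n2. n \<le> n1 \<and> n1 < n2 \<and> {n1<..<n2} \<inter> E = {}}"
      by (intro bdd_aboveI[of _ "\<mu> n"]) blast
  qed (use assms in blast)
  then show ?thesis by linarith
qed

lemma scaled_gap_le:
  assumes "scaling_function \<mu>"
    and "\<And>n1 n2. \<lbrakk>n \<le> n1; n1 < n2; {n1<..<n2} \<inter> E = {}\<rbrakk> \<Longrightarrow> \<mu> n1 - \<mu> n2 \<le> C"
  shows "scaled_gap \<mu> E n \<le> C"
  unfolding scaled_gap_def
proof (rule cSup_least)
  have "{n<..<Suc n} \<inter> E = {}" by auto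
  then show "{\<bar>\<mu> n1 - \<mu> n2\<bar> | n1 n2. n \<le> n1 \<and> n1 < n2 \<and> {n1<..<n2} \<inter> E = {}} \<noteq> {}"
    by blast
next
  fix x assume "x \<in> {\<bar>\<mu> n1 - \<mu> n2\<bar> | n1 n2. n \<le> n1 \<and> n1 < n2 \<and> {n1<..<n2} \<inter> E = {}}"
  then obtain n1 n2 where n: "x = \<bar>\<mu> n1 - \<mu> n2\<bar>" "n \<le> n1" "n1 < n2" "{n1<..<n2} \<inter> E = {}"
    by blast
  then show "x \<le> C"
    using assms(2)[of n1 n2] scaling_function_less_iff[OF assms(1), of n2 n1] by simp
qed

lemma scaled_gap_nonneg:
  assumes "scaling_function \<mu>"
  shows "0 \<le> scaled_gap \<mu> E n"
proof -
  have "{n<..<Suc n} \<inter> E = {}" by auto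
  then have "\<mu> n - \<mu> (Suc n) \<le> scaled_gap \<mu> E n"
    using scaled_gap_ge[OF assms] by blast
  then show ?thesis
    using scaling_function_less_iff[OF assms, of "Suc n" n] by simp
qed

lemma scaled_gap_antimono:
  assumes "scaling_function \<mu>" "m \<le> n"
  shows "scaled_gap \<mu> E n \<le> scaled_gap \<mu> E m"
  using assms by (intro scaled_gap_le) (auto intro!: scaled_gap_ge)

section \<open>Comparison of index gaps with real gaps\<close>

lemma scaled_gap_le_gap_length:
  assumes "scaling_function \<mu>"
  shows "scaled_gap \<mu> E n \<le> gap_length (\<mu> ` E) (\<mu> n)"
proof (rule scaled_gap_le[OF assms])
  fix n1 n2 assume n: "n \<le> n1" "n1 < n2" "{n1<..<n2} \<inter> E = {}"
  show "\<mu> n1 - \<mu> n2 \<le> gap_length (\<mu> ` E) (\<mu> n)"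
  proof (rule gap_length_ge)
    show "\<mu> n2 \<le> \<mu> n1"
      using n by (simp add: scaling_function_le_iff[OF assms])
    show "{\<mu> n2<..<\<mu> n1} \<subseteq> {0<..<\<mu> n}"
      using n scaling_function_pos[OF assms, of n2] scaling_function_le_iff[OF assms, of n1 n] by auto
    \<comment> \<open>Since \<open>\<mu>\<close> reverses the order strictly, a value in this
      interval has its index strictly between \<open>n1\<close> and \<open>n2\<close>.\<close>
    show "{\<mu> n2<..<\<mu> n1} \<inter> \<mu> ` E = {}"
      using n by (auto simp: scaling_function_less_iff[OF assms])
  qed (rule scaling_function_pos[OF assms])
qed

text \<open>The left end \<open>a\<close> need not be a value of \<open>\<mu>\<close>. Moving it
  down to the next value gives an index gap at least as long; for \<open>a = 0\<close> there is no
  next value and a limit takes its place.\<close>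

lemma scaled_gap_ge_real:
  assumes \<mu>: "scaling_function \<mu>" and a: "0 \<le> a" "a < \<mu> k"
    and gap: "{a<..<\<mu> k} \<inter> \<mu> ` E = {}"
  shows "\<mu> k - a \<le> scaled_gap \<mu> E k"
proof -
  \<comment> \<open>Only indices up to \<open>j\<close> lie inside the index gap, and their values
    exceed \<open>a\<close>; \<open>\<mu> (Suc j)\<close> itself may be at or below
    \<open>a\<close>.\<close>
  have *: "\<mu> k - \<mu> (Suc j) \<le> scaled_gap \<mu> E k" if "k \<le> j" "a < \<mu> j" for j
  proof (rule scaled_gap_ge[OF \<mu>])
    have False if i: "k < i" "i \<le> j" "i \<in> E" for i
    proof -
      have "a < \<mu> i"
        using \<open>a < \<mu> j\<close> i scaling_function_le_iff[OF \<mu>, of j i] by linarith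
      moreover have "\<mu> i < \<mu> k"
        using i by (simp add: scaling_function_less_iff[OF \<mu>])
      ultimately show False using gap i by auto
    qed
    then show "{k<..<Suc j} \<inter> E = {}" by force
  qed (use that in auto)
  show ?thesis
  proof (cases "a = 0")
    case True
    \<comment> \<open>Every \<open>j \<ge> k\<close> is admissible in \<open>*\<close>, so the bound
      survives as \<open>\<mu> (Suc j)\<close> tends to 0.\<close>
    have lim: "(\<lambda>j. \<mu> k - \<mu> (Suc j)) \<longlonglongrightarrow> \<mu> k - 0"
      by (intro tendsto_intros LIMSEQ_Suc scaling_function_tendsto[OF \<mu>])
    show ?thesis
      unfolding True
      by (rule LIMSEQ_le_const2[OF lim]) (use * True scaling_function_pos[OF \<mu>] in blast)
  next
    case False
    have "\<forall>\<^sub>F n in sequentially. \<mu> n \<le> a"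
      using order_tendstoD(2)[OF scaling_function_tendsto[OF \<mu>], of a] False a
      by (auto elim!: eventually_mono)
    then obtain N where "\<mu> N \<le> a"
      by (auto simp: eventually_sequentially)
    \<comment> \<open>By minimality the predecessor of \<open>n\<close> still has a value above
      \<open>a\<close>, as \<open>*\<close> requires.\<close>
    moreover define n where "n = (LEAST n. \<mu> n \<le> a)"
    ultimately have n: "\<mu> n \<le> a"
      by (metis LeastI)
    then have kn: "k < n"
      using a scaling_function_less_iff[OF \<mu>] by (meson le_less_trans)
    then obtain j where j: "n = Suc j"
      by (cases n) auto
    have "a < \<mu> j"
      using not_less_Least[of j "\<lambda>n. \<mu> n \<le> a"] j by (simp add: n_def)
    then have "\<mu> k - \<mu> n \<le> scaled_gap \<mu> E k"
      using * j kn by simp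
    then show ?thesis using n by simp
  qed
qed

lemma gap_length_quotient_le:
  assumes \<mu>: "scaling_function \<mu>" and h: "\<mu> (Suc n) < h" "h \<le> \<mu> n"
  shows "gap_length (\<mu> ` E) h / h
    \<le> max (scaled_gap \<mu> E n / \<mu> n) (scaled_gap \<mu> E (Suc n) / \<mu> (Suc n))" (is "_ \<le> ?M")
proof -
  note pos = scaling_function_pos[OF \<mu>]
  have h0: "0 < h" using h(1) pos[of "Suc n"] by linarith
  have M: "0 \<le> ?M"
    using scaled_gap_nonneg[OF \<mu>, of E n] pos[of n] by (simp add: le_max_iff_disj)
  have "gap_length (\<mu> ` E) h \<le> ?M * h"
  proof (rule gap_length_le)
    show "0 \<le> ?M * h" using M h0 by simp
  next
    fix a b assume ab: "0 \<le> a" "a < b" "b \<le> h" "{a<..<b} \<inter> \<mu> ` E = {}"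
    \<comment> \<open>The bracket is taken around \<open>b\<close> rather than \<open>h\<close>;
      \<open>b \<le> h \<le> \<mu> n\<close> gives \<open>n \<le> k\<close>.\<close>
    obtain k where k: "n \<le> k" "\<mu> (Suc k) < b" "b \<le> \<mu> k"
      using scaling_function_bracket[OF \<mu>, of b n] ab h by auto
    have "{a<..<\<mu> k} \<inter> \<mu> ` E = {}"
    proof -
      \<comment> \<open>Values below \<open>\<mu> k\<close> are at most
        \<open>\<mu> (Suc k)\<close>, so raising the right end from \<open>b\<close> to
        \<open>\<mu> k\<close> picks up no new point.\<close>
      have "\<mu> i < b" if "\<mu> i < \<mu> k" for i
        using that k(2) scaling_function_le_iff[OF \<mu>, of i "Suc k"]
        by (simp add: scaling_function_less_iff[OF \<mu>])
      then show ?thesis using ab(4) by fastforce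
    qed
    then have gap: "\<mu> k - a \<le> scaled_gap \<mu> E k"
      using scaled_gap_ge_real[OF \<mu>] ab k by simp
    have "(b - a) / h \<le> ?M"
    proof (cases "k = n")
      case True
      have "(b - a) / h \<le> (h - a) / h"
        using ab h0 by (simp add: divide_right_mono)
      also have "\<dots> = 1 - a / h"
        using h0 by (simp add: diff_divide_distrib)
      \<comment> \<open>As \<open>a \<ge> 0\<close>, enlarging \<open>h\<close> to
        \<open>\<mu> n\<close> can only increase the relative length of a gap reaching up to the
        scale.\<close>
      also have "\<dots> \<le> 1 - a / \<mu> n"
        using divide_left_mono[of h "\<mu> n" a] h h0 ab pos[of n] by simp
      also have "\<dots> = (\<mu> n - a) / \<mu> n"
        using pos[of n] by (simp add: diff_divide_distrib)
      also have "\<dots> \<le> scaled_gap \<mu> E n / \<mu> n"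
        using gap True pos[of n] by (simp add: divide_right_mono)
      finally show ?thesis by simp
    next
      case False
      \<comment> \<open>Now \<open>k \<ge> Suc n\<close>, so the gap is counted at
        \<open>Suc n\<close>; dividing by \<open>\<mu> (Suc n) < h\<close> only enlarges the
        quotient.\<close>
      have "b - a \<le> scaled_gap \<mu> E (Suc n)"
        using gap k False scaled_gap_antimono[OF \<mu>, of "Suc n" k E] by simp
      then have "(b - a) / h \<le> scaled_gap \<mu> E (Suc n) / \<mu> (Suc n)"
        using ab h pos[of "Suc n"] by (intro frac_le) auto
      then show ?thesis by simp
    qed
    then show "b - a \<le> ?M * h"
      using h0 by (simp add: pos_divide_le_eq)
  qed
  then show ?thesis
    using h0 by (simp add: pos_divide_le_eq)
qed

section \<open>The two inequalities between the upper limits\<close>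

lemma upper_porosity_at_infinity_le:
  assumes \<mu>: "scaling_function \<mu>"
  shows "upper_porosity_at_infinity \<mu> E \<le> right_upper_porosity (\<mu> ` E)"
  unfolding right_upper_porosity_def Limsup_le_iff upper_porosity_at_infinity_def
proof (intro allI impI)
  fix y assume y: "Limsup (at_right 0) (\<lambda>h. ereal (gap_length (\<mu> ` E) h / h)) < y"
  \<comment> \<open>Positivity makes \<open>\<mu>\<close> approach 0 from the right, so the scales
    \<open>h = \<mu> n\<close> sample the continuous upper limit.\<close>
  have "filterlim \<mu> (at_right 0) sequentially"
    using scaling_function_tendsto[OF \<mu>] scaling_function_pos[OF \<mu>]
    by (simp add: filterlim_at less_imp_neq[THEN not_sym])
  then have "\<forall>\<^sub>F n in sequentially. ereal (gap_length (\<mu> ` E) (\<mu> n) / \<mu> n) < y"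
    using Limsup_lessD[OF y] unfolding filterlim_iff by blast
  then show "\<forall>\<^sub>F n in sequentially. ereal (scaled_gap \<mu> E n / \<mu> n) < y"
  proof (rule eventually_mono)
    fix n assume "ereal (gap_length (\<mu> ` E) (\<mu> n) / \<mu> n) < y"
    moreover have "scaled_gap \<mu> E n / \<mu> n \<le> gap_length (\<mu> ` E) (\<mu> n) / \<mu> n"
      using scaled_gap_le_gap_length[OF \<mu>] scaling_function_pos[OF \<mu>, of n]
      by (simp add: divide_right_mono)
    ultimately show "ereal (scaled_gap \<mu> E n / \<mu> n) < y"
      by (meson ereal_less_eq(3) le_less_trans)
  qed
qed

lemma right_upper_porosity_le:
  assumes \<mu>: "scaling_function \<mu>"
  shows "right_upper_porosity (\<mu> ` E) \<le> upper_porosity_at_infinity \<mu> E"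
  unfolding right_upper_porosity_def Limsup_le_iff upper_porosity_at_infinity_def
proof (intro allI impI)
  fix y assume "limsup (\<lambda>n. ereal (scaled_gap \<mu> E n / \<mu> n)) < y"
  then have "\<forall>\<^sub>F n in sequentially. ereal (scaled_gap \<mu> E n / \<mu> n) < y"
    by (rule Limsup_lessD)
  then obtain N where N: "ereal (scaled_gap \<mu> E n / \<mu> n) < y" if "N \<le> n" for n
    by (auto simp: eventually_sequentially)
  have "ereal (gap_length (\<mu> ` E) h / h) < y" if h: "0 < h" "h < \<mu> N" for h
  proof -
    \<comment> \<open>Both \<open>n\<close> and \<open>Suc n\<close> are at least \<open>N\<close>,
      so each term of the maximum is below \<open>y\<close>.\<close>
    obtain n where n: "N \<le> n" "\<mu> (Suc n) < h" "h \<le> \<mu> n"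
      using scaling_function_bracket[OF \<mu>, of h N] h by auto
    have "ereal (gap_length (\<mu> ` E) h / h)
        \<le> ereal (max (scaled_gap \<mu> E n / \<mu> n) (scaled_gap \<mu> E (Suc n) / \<mu> (Suc n)))"
      using gap_length_quotient_le[OF \<mu> n(2,3)] by (simp only: ereal_less_eq)
    also have "\<dots> < y"
      using N[of n] N[of "Suc n"] n(1) by (auto simp: max_def)
    finally show ?thesis .
  qed
  then show "\<forall>\<^sub>F h in at_right 0. ereal (gap_length (\<mu> ` E) h / h) < y"
    using scaling_function_pos[OF \<mu>, of N] by (auto simp: eventually_at_right_field)
qed

theorem theorem3p11:
  fixes E :: "nat set"
  shows "\<forall>\<mu>. scaling_function \<mu> \<longrightarrow>
           right_upper_porosity (\<mu> ` E) = upper_porosity_at_infinity \<mu> E"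
  by (simp add: antisym right_upper_porosity_le upper_porosity_at_infinity_le)

end
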